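(* Let $F=(f_1,\dots,f_m)^T:\mathbb{R}^n\to\mathbb{R}^m$ with $f_i=g_i+h_i$, where each $g_i:\mathbb{R}^n\to\mathbb{R}$ is twice continuously differentiable and strongly convex and each $h_i:\mathbb{R}^n\to\mathbb{R}$ is convex (not necessarily differentiable). Let $\{x^k\}$ be an infinite sequence generated by the BFGS quasi-Newton algorithm with Armijo line search described in the context, with matrices $B_i^k$. (i) Assume that there is a constant $\sigma>0$ such that $z^TB_i^kz\ge\sigma\|z\|^2$ for all $z\in\mathbb{R}^n$, all $k\ge 0$ and all $i=1,\dots,m$, and that the sequence $\{f_i(x^k)\}_k$ is bounded from below for every $i=1,\dots,m$. Then every accumulation point of $\{x^k\}$, if one exists, is both a Pareto stationary point and a Pareto optimum of the problem $\min_{x\in\mathbb{R}^n}F(x)$. (ii) Moreover, if in addition the level set $\{x\in\mathbb{R}^n: F(x)\le F(x^0)\}$ is bounded, then $\{x^k\}$ has accumulation points, and they are all Pareto stationary points and Pareto optima of $\min_{x\in\mathbb{R}^n}F(x)$.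
   Context: Vector inequalities: for $u,v\in\mathbb{R}^m$, $u\le v$ means $u_i\le v_i$ for all $i$. A function $g:\mathbb{R}^n\to\mathbb{R}$ is strongly convex if there is $\eta>0$ with $g(\lambda x+(1-\lambda)y)\le\lambda g(x)+(1-\lambda)g(y)-\frac12\lambda(1-\lambda)\eta\|x-y\|^2$ for all $x,y\in\mathbb{R}^n$, $\lambda\in[0,1]$. A point $x^*\in\mathbb{R}^n$ is a Pareto optimum (efficient point) if there is no $x\in\mathbb{R}^n$ with $F(x)\le F(x^* )$ and $F(x)\neq F(x^* )$. A point $\bar x\in\mathbb{R}^n$ is Pareto stationary (critical) if $\max_{i=1,\dots,m}f_i'(\bar x;d)\ge0$ for all $d\in\mathbb{R}^n$, where $f_i'(x;d)=\lim_{\alpha\to0^+}\frac{f_i(x+\alpha d)-f_i(x)}{\alpha}$. Algorithm. Choose $\rho\in(0,1)$, $\zeta\in(0,1)$, $x^0\in\mathbb{R}^n$, and symmetric positive definite matrices $B_i^0\in\mathbb{R}^{n\times n}$, $i=1,\dots,m$. For $k=0,1,2,\dots$: 1. Let $d^k$ and $\alpha(x^k)$ be the unique minimizer and the optimal value of $$\min_{d\in\mathbb{R}^n}\ \max_{i=1,\dots,m}\Big\{\nabla g_i(x^k)^Td+\tfrac12 d^TB_i^kd+h_i(x^k+d)-h_i(x^k)\Big\}.$$ 2. If $d^k=0$, stop. 3. Let $\lambda_k$ be the maximum of the set of all $\lambda=\zeta^j$, $j\in\{0,1,2,\dots\}$, such that $f_i(x^k+\lambda d^k)\le f_i(x^k)+\lambda\rho\,\alpha(x^k)$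 for all $i=1,\dots,m$. 4. Set $x^{k+1}=x^k+\lambda_kd^k$, $s^k=x^{k+1}-x^k$, $y_i^k=\nabla g_i(x^{k+1})-\nabla g_i(x^k)$ and, for each $i=1,\dots,m$, $$B_i^{k+1}=B_i^k-\frac{B_i^ks^k(s^k)^TB_i^k}{(s^k)^TB_i^ks^k}+\frac{y_i^k(y_i^k)^T}{(s^k)^Ty_i^k}.$$ The algorithm either stops at step 2 or produces an infinite sequence; the statement concerns the latter case. *)

theory Defs
  imports "HOL-Analysis.Analysis"
begin

definition grad :: "(real ^ 'n \<Rightarrow> real) \<Rightarrow> real ^ 'n \<Rightarrow> real ^ 'n" where
  "grad g x = (THE D. GDERIV g x :> D)"

text \<open>Twice continuously differentiable on the whole space; the matrix function \<open>H\<close> is the Hessian.\<close>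

definition twice_continuously_differentiable :: "(real ^ 'n \<Rightarrow> real) \<Rightarrow> bool" where
  "twice_continuously_differentiable g \<longleftrightarrow>
     (\<forall>x. GDERIV g x :> grad g x) \<and>
     (\<exists>H :: real ^ 'n \<Rightarrow> real ^ 'n ^ 'n.
        (\<forall>x. (grad g has_derivative (\<lambda>v. H x *v v)) (at x)) \<and> continuous_on UNIV H)"

definition strongly_convex :: "(real ^ 'n \<Rightarrow> real) \<Rightarrow> bool" where
  "strongly_convex g \<longleftrightarrow>
     (\<exists>\<eta>>0. \<forall>x y. \<forall>t\<in>{0..1}.
        g (t *\<^sub>R x + (1 - t) *\<^sub>R y)
          \<le> t * g x + (1 - t) * g y - 1 / 2 * t * (1 - t) * \<eta> * (norm (x - y))\<^sup>2)"

definition symmetric_positive_definite :: "real ^ 'n ^ 'n \<Rightarrow> bool" where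
  "symmetric_positive_definite A \<longleftrightarrow> transpose A = A \<and> (\<forall>z. z \<noteq> 0 \<longrightarrow> z \<bullet> (A *v z) > 0)"

text \<open>The type of vectors carries the componentwise order, so \<open>\<le>\<close> below is the
  vector inequality.\<close>

definition pareto_optimum :: "(real ^ 'n \<Rightarrow> real ^ 'm) \<Rightarrow> real ^ 'n \<Rightarrow> bool" where
  "pareto_optimum F p \<longleftrightarrow> \<not> (\<exists>x. F x \<le> F p \<and> F x \<noteq> F p)"

text \<open>The limit exists for all functions considered here, which are sums of a
  differentiable and a finite convex function; \<open>Lim\<close> is unspecified otherwise.\<close>

definition directional_derivative :: "(real ^ 'n \<Rightarrow> real) \<Rightarrow> real ^ 'n \<Rightarrow> real ^ 'n \<Rightarrow> real" where
  "directional_derivative f x d = Lim (at_right 0) (\<lambda>a. (f (x + a *\<^sub>R d) - f x) / a)"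

definition pareto_stationary :: "(real ^ 'n \<Rightarrow> real ^ 'm) \<Rightarrow> real ^ 'n \<Rightarrow> bool" where
  "pareto_stationary F p \<longleftrightarrow>
     (\<forall>d. (MAX i. directional_derivative (\<lambda>x. F x $ i) p d) \<ge> 0)"

definition accumulation_point :: "(nat \<Rightarrow> 'a::topological_space) \<Rightarrow> 'a \<Rightarrow> bool" where
  "accumulation_point x p \<longleftrightarrow> (\<exists>r. strict_mono r \<and> (x \<circ> r) \<longlonglongrightarrow> p)"

definition subproblem ::
  "('m::finite \<Rightarrow> real ^ 'n \<Rightarrow> real) \<Rightarrow> ('m \<Rightarrow> real ^ 'n \<Rightarrow> real) \<Rightarrow> ('m \<Rightarrow> real ^ 'n ^ 'n) \<Rightarrow>
     real ^ 'n \<Rightarrow> real ^ 'n \<Rightarrow> real" where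
  "subproblem g h B x d =
     (MAX i. grad (g i) x \<bullet> d + 1 / 2 * (d \<bullet> (B i *v d)) + h i (x + d) - h i x)"

text \<open>The rank-one matrices of the update are products of a column and a row vector.\<close>

definition bfgs_update :: "real ^ 'n ^ 'n \<Rightarrow> real ^ 'n \<Rightarrow> real ^ 'n \<Rightarrow> real ^ 'n ^ 'n" where
  "bfgs_update B s y =
     B - (B ** (columnvector s :: real ^ 1 ^ 'n) ** (rowvector s :: real ^ 'n ^ 1) ** B)
           /\<^sub>R (s \<bullet> (B *v s))
       + ((columnvector y :: real ^ 1 ^ 'n) ** (rowvector y :: real ^ 'n ^ 1)) /\<^sub>R (s \<bullet> y)"

definition armijo_steps ::
  "real \<Rightarrow> real \<Rightarrow> (real ^ 'n \<Rightarrow> real ^ 'm) \<Rightarrow> real ^ 'n \<Rightarrow> real ^ 'n \<Rightarrow> real \<Rightarrow> real set" where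
  "armijo_steps \<rho> \<zeta> F x d \<alpha> =
     {l. (\<exists>j::nat. l = \<zeta> ^ j) \<and> (\<forall>i. F (x + l *\<^sub>R d) $ i \<le> F x $ i + l * \<rho> * \<alpha>)}"

text \<open>A run of the algorithm that never stops: \<open>x\<close> are the iterates, \<open>B k i\<close> the matrices,
  \<open>d\<close> the search directions, \<open>\<alpha>\<close> the optimal values of the subproblems and \<open>l\<close> the step sizes.\<close>

definition infinite_bfgs_run ::
  "('m::finite \<Rightarrow> real ^ 'n \<Rightarrow> real) \<Rightarrow> ('m \<Rightarrow> real ^ 'n \<Rightarrow> real) \<Rightarrow> real \<Rightarrow> real \<Rightarrow>
     (nat \<Rightarrow> real ^ 'n) \<Rightarrow> (nat \<Rightarrow> 'm \<Rightarrow> real ^ 'n ^ 'n) \<Rightarrow>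
     (nat \<Rightarrow> real ^ 'n) \<Rightarrow> (nat \<Rightarrow> real) \<Rightarrow> (nat \<Rightarrow> real) \<Rightarrow> bool" where
  "infinite_bfgs_run g h \<rho> \<zeta> x B d \<alpha> l \<longleftrightarrow>
     (\<forall>i. symmetric_positive_definite (B 0 i)) \<and>
     (\<forall>k. {e. is_arg_min (subproblem g h (B k) (x k)) (\<lambda>_. True) e} = {d k}
        \<and> \<alpha> k = subproblem g h (B k) (x k) (d k)
        \<and> d k \<noteq> 0
        \<and> (let S = armijo_steps \<rho> \<zeta> (\<lambda>z. \<chi> i. g i z + h i z) (x k) (d k) (\<alpha> k)
            in l k \<in> S \<and> (\<forall>t\<in>S. t \<le> l k))
        \<and> x (Suc k) = x k + l k *\<^sub>R d k
        \<and> (\<forall>i. B (Suc k) i =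
              bfgs_update (B k i) (x (Suc k) - x k) (grad (g i) (x (Suc k)) - grad (g i) (x k))))"

end

theory Submission
  imports Defs
begin

text \<open>The functions \<open>f i\<close> are strongly convex, so the iterates stay in a bounded set. The lower
  bound on the matrices keeps the step sizes away from zero, and the Armijo condition makes
  \<open>\<Sum>k. \<bar>\<alpha> k\<bar>\<close> finite. The matrices need not be bounded above, but each BFGS update increases
  their quadratic forms by at most a constant multiple of \<open>(norm z)\<^sup>2\<close>, so they are \<open>O(k)\<close>.
  If an accumulation point \<open>p\<close> were not a Pareto optimum, some fixed point \<open>w\<close> would improve every
  objective at every iterate by a fixed amount, because the values decrease along the run to those
  at \<open>p\<close>; moving a fraction of order \<open>1 / k\<close> from \<open>x k\<close> towards \<open>w\<close> then gives \<open>\<bar>\<alpha> k\<bar> \<ge> c / (k + 1)\<close>,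
  which contradicts the divergence of the harmonic series. Stationarity follows from
  optimality and convexity.\<close>

section \<open>Strongly convex functions\<close>

lemma strongly_convex_imp_convex:
  fixes f :: "real ^ 'n \<Rightarrow> real"
  assumes "strongly_convex f"
  shows "convex_on UNIV f"
proof -
  obtain \<eta> where \<eta>: "\<eta> > 0" and *: "\<And>x y t. t \<in> {0..1} \<Longrightarrow> f (t *\<^sub>R x + (1 - t) *\<^sub>R y)
      \<le> t * f x + (1 - t) * f y - 1 / 2 * t * (1 - t) * \<eta> * (norm (x - y))\<^sup>2"
    using assms unfolding strongly_convex_def by blast
  show ?thesis
  proof (rule convex_onI)
    fix t :: real and x y :: "real ^ 'n"
    assume t: "0 < t" "t < 1"
    have "0 \<le> 1 / 2 * (1 - t) * (1 - (1 - t)) * \<eta> * (norm (x - y))\<^sup>2"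
      using t \<eta> by simp
    then show "f ((1 - t) *\<^sub>R x + t *\<^sub>R y) \<le> (1 - t) * f x + t * f y"
      using *[of "1 - t" x y] t by simp
  qed simp
qed

lemma strongly_convex_add_convex:
  fixes f h :: "real ^ 'n \<Rightarrow> real"
  assumes "strongly_convex f" "convex_on UNIV h"
  shows "strongly_convex (\<lambda>z. f z + h z)"
proof -
  obtain \<eta> where \<eta>: "\<eta> > 0" and *: "\<And>x y t. t \<in> {0..1} \<Longrightarrow> f (t *\<^sub>R x + (1 - t) *\<^sub>R y)
      \<le> t * f x + (1 - t) * f y - 1 / 2 * t * (1 - t) * \<eta> * (norm (x - y))\<^sup>2"
    using assms(1) unfolding strongly_convex_def by blast
  have "f (t *\<^sub>R x + (1 - t) *\<^sub>R y) + h (t *\<^sub>R x + (1 - t) *\<^sub>R y)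
      \<le> t * (f x + h x) + (1 - t) * (f y + h y) - 1 / 2 * t * (1 - t) * \<eta> * (norm (x - y))\<^sup>2"
    if "t \<in> {0..1}" for x y t
  proof -
    have "h (t *\<^sub>R x + (1 - t) *\<^sub>R y) \<le> t * h x + (1 - t) * h y"
      using convex_onD[OF assms(2), of "1 - t" x y] that by simp
    then show ?thesis
      using *[OF that, of x y] by (simp add: algebra_simps)
  qed
  then show ?thesis
    unfolding strongly_convex_def using \<eta> by blast
qed

lemma convex_continuous_on_UNIV:
  fixes f :: "real ^ 'n \<Rightarrow> real"
  assumes "convex_on UNIV f"
  shows "continuous_on UNIV f"
  using assms by (intro convex_on_continuous) auto

lemma continuous_bounded_on_cball:
  fixes f :: "real ^ 'n \<Rightarrow> 'b::real_normed_vector"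
  assumes "continuous_on UNIV f"
  obtains A where "A > 0" "\<And>x. norm x \<le> R \<Longrightarrow> norm (f x) \<le> A"
proof -
  have "bounded (f ` cball 0 R)"
    using assms by (intro compact_imp_bounded compact_continuous_image)
      (auto intro: continuous_on_subset)
  then obtain A where "A > 0" "\<forall>y\<in>f ` cball 0 R. norm y \<le> A"
    unfolding bounded_pos by auto
  then show ?thesis
    using that by auto
qed

text \<open>On the segment from 0 to a far point \<open>z\<close>, the point
  \<open>t *\<^sub>R z\<close> of norm 1 has a value of at least \<open>- A\<close>. The strong
  convexity term at that point grows linearly in \<open>norm z\<close>, so a bound on
  \<open>f z\<close> limits \<open>norm z\<close>.\<close>

lemma strongly_convex_bounded_sublevel:
  fixes f :: "real ^ 'n \<Rightarrow> real"
  assumes "strongly_convex f"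
  shows "bounded {z. f z \<le> c}"
proof -
  obtain \<eta> where \<eta>: "\<eta> > 0" and *: "\<And>x y t. t \<in> {0..1} \<Longrightarrow> f (t *\<^sub>R x + (1 - t) *\<^sub>R y)
      \<le> t * f x + (1 - t) * f y - 1 / 2 * t * (1 - t) * \<eta> * (norm (x - y))\<^sup>2"
    using assms unfolding strongly_convex_def by blast
  obtain A where A: "A > 0" "\<And>x. norm x \<le> 1 \<Longrightarrow> norm (f x) \<le> A"
    using continuous_bounded_on_cball
      [OF convex_continuous_on_UNIV[OF strongly_convex_imp_convex[OF assms]]] by blast
  have "norm z \<le> 1 + 2 * (\<bar>c\<bar> + 2 * A) / \<eta>" if z: "f z \<le> c" for z
  proof (cases "norm z \<le> 1")
    case True
    have "0 \<le> 2 * (\<bar>c\<bar> + 2 * A) / \<eta>" using \<eta> A(1) by simp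
    then show ?thesis using True by linarith
  next
    case False
    define t where "t = 1 / norm z"
    have t: "0 < t" "t < 1" "t * norm z = 1"
      using False by (auto simp: t_def divide_less_eq_1 not_le simp del: zero_less_norm_iff)
    have "- A \<le> f (t *\<^sub>R z)" using A(2)[of "t *\<^sub>R z"] t by simp
    moreover have "f (t *\<^sub>R z) \<le> t * f z + (1 - t) * f 0 - 1 / 2 * t * (1 - t) * \<eta> * (norm z)\<^sup>2"
      using *[of t z 0] t by simp
    \<comment> \<open>Since \<open>t * norm z = 1\<close>, the factor
      \<open>t * (1 - t) * (norm z)\<^sup>2\<close> collapses to \<open>norm z - 1\<close>.\<close>
    moreover have "1 / 2 * t * (1 - t) * \<eta> * (norm z)\<^sup>2 = 1 / 2 * \<eta> * (norm z - 1)"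
    proof -
      have "1 / 2 * t * (1 - t) * \<eta> * (norm z)\<^sup>2
          = 1 / 2 * \<eta> * ((t * norm z) * (norm z - t * norm z))"
        by (simp add: power2_eq_square field_simps)
      then show ?thesis using t(3) by simp
    qed
    moreover have "t * f z \<le> \<bar>c\<bar>"
    proof -
      have "t * f z \<le> t * \<bar>c\<bar>" using z t by (intro mult_left_mono) auto
      also have "\<dots> \<le> \<bar>c\<bar>" using t by (simp add: mult_left_le_one_le)
      finally show ?thesis .
    qed
    moreover have "(1 - t) * f 0 \<le> A"
    proof -
      have "(1 - t) * f 0 \<le> (1 - t) * A" using A(2)[of 0] t by (intro mult_left_mono) auto
      also have "\<dots> \<le> A" using t A(1) by (simp add: mult_left_le_one_le)
      finally show ?thesis .
    qed
    ultimately have "1 / 2 * \<eta> * (norm z - 1) \<le> \<bar>c\<bar> + 2 * A" by linarith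
    then show ?thesis using \<eta> by (simp add: field_simps)
  qed
  then show ?thesis unfolding bounded_iff by blast
qed

text \<open>Divide the strong convexity inequality on the segment from \<open>x\<close> to
  \<open>w\<close> by \<open>t\<close> and let \<open>t\<close> tend to 0 from the right. The
  modulus \<open>\<eta>\<close> stays explicit because the bound on the BFGS increments depends on
  it.\<close>

lemma strongly_convex_gradient_inequality:
  fixes g :: "real ^ 'n \<Rightarrow> real"
  assumes sc: "\<And>x y t. t \<in> {0..1} \<Longrightarrow> g (t *\<^sub>R x + (1 - t) *\<^sub>R y)
      \<le> t * g x + (1 - t) * g y - 1 / 2 * t * (1 - t) * \<eta> * (norm (x - y))\<^sup>2"
    and D: "GDERIV g x :> D"
  shows "D \<bullet> (w - x) \<le> g w - g x - 1 / 2 * \<eta> * (norm (w - x))\<^sup>2"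
proof -
  define v where "v = w - x"
  have "((\<lambda>t::real. g (x + t *\<^sub>R v)) has_real_derivative v \<bullet> D) (at 0)"
  proof -
    have "(g has_derivative (\<lambda>h. h \<bullet> D)) (at (x + (0::real) *\<^sub>R v))"
      using D by (simp add: gderiv_def)
    moreover have "((\<lambda>t::real. x + t *\<^sub>R v) has_derivative (\<lambda>t. t *\<^sub>R v)) (at 0)"
      by (auto intro!: derivative_eq_intros)
    ultimately have "(g \<circ> (\<lambda>t::real. x + t *\<^sub>R v) has_derivative (\<lambda>h. h \<bullet> D) \<circ> (\<lambda>t. t *\<^sub>R v)) (at 0)"
      by (intro diff_chain_at) auto
    then show ?thesis
      by (simp add: has_field_derivative_def o_def mult.commute[of _ "v \<bullet> D"])
  qed
  then have "((\<lambda>t. (g (x + t *\<^sub>R v) - g x) / t) \<longlongrightarrow> v \<bullet> D) (at_right 0)"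
    by (auto simp: DERIV_def intro: tendsto_mono[OF at_le])
  moreover have "((\<lambda>t::real. g w - g x - 1 / 2 * (1 - t) * \<eta> * (norm v)\<^sup>2)
      \<longlongrightarrow> g w - g x - 1 / 2 * (1 - 0) * \<eta> * (norm v)\<^sup>2) (at_right 0)"
    by (intro tendsto_intros)
  moreover have "\<forall>\<^sub>F t in at_right 0. (g (x + t *\<^sub>R v) - g x) / t
      \<le> g w - g x - 1 / 2 * (1 - t) * \<eta> * (norm v)\<^sup>2"
  proof -
    have "(g (x + t *\<^sub>R v) - g x) / t \<le> g w - g x - 1 / 2 * (1 - t) * \<eta> * (norm v)\<^sup>2"
      if "0 < t" "t < 1" for t
    proof -
      have "t *\<^sub>R w + (1 - t) *\<^sub>R x = x + t *\<^sub>R v" by (simp add: v_def algebra_simps)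
      then have "g (x + t *\<^sub>R v) - g x \<le> t * (g w - g x - 1 / 2 * (1 - t) * \<eta> * (norm v)\<^sup>2)"
        using sc[of t w x] that by (simp add: v_def algebra_simps)
      then show ?thesis using that by (simp add: pos_divide_le_eq mult.commute)
    qed
    then show ?thesis
      by (auto simp: eventually_at_right_field intro!: exI[of _ 1])
  qed
  ultimately have "v \<bullet> D \<le> g w - g x - 1 / 2 * (1 - 0) * \<eta> * (norm v)\<^sup>2"
    by (intro tendsto_le[OF trivial_limit_at_right_real])
  then show ?thesis by (simp add: v_def inner_commute)
qed

text \<open>Add the gradient inequalities at \<open>x\<close> and at \<open>w\<close>: the function
  values cancel and the two halves of the quadratic term combine. In the BFGS update this bounds the
  denominator \<open>s \<bullet> y\<close> from below.\<close>

lemma strongly_convex_gradient_monotone: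
  fixes g :: "real ^ 'n \<Rightarrow> real"
  assumes sc: "\<And>x y t. t \<in> {0..1} \<Longrightarrow> g (t *\<^sub>R x + (1 - t) *\<^sub>R y)
      \<le> t * g x + (1 - t) * g y - 1 / 2 * t * (1 - t) * \<eta> * (norm (x - y))\<^sup>2"
    and "GDERIV g x :> D" "GDERIV g w :> E"
  shows "\<eta> * (norm (w - x))\<^sup>2 \<le> (w - x) \<bullet> (E - D)"
proof -
  have "E \<bullet> (x - w) = - (E \<bullet> (w - x))"
    by (simp add: inner_diff_right)
  then show ?thesis
    using strongly_convex_gradient_inequality[OF sc assms(2), of w]
      strongly_convex_gradient_inequality[OF sc assms(3), of x]
    by (simp add: norm_minus_commute inner_diff_right inner_diff_left inner_commute)
qed

section \<open>Gradients of twice continuously differentiable functions\<close>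

text \<open>A continuous Hessian is bounded on the compact ball, and the ball is convex, so the mean
  value inequality applies to the gradient.\<close>

lemma twice_continuously_differentiable_grad_lipschitz:
  fixes g :: "real ^ 'n \<Rightarrow> real"
  assumes "twice_continuously_differentiable g"
  obtains L where "L > 0"
    "\<And>x y. norm x \<le> R \<Longrightarrow> norm y \<le> R \<Longrightarrow> norm (grad g x - grad g y) \<le> L * norm (x - y)"
proof -
  obtain H :: "real ^ 'n \<Rightarrow> real ^ 'n ^ 'n" where
    H: "\<And>x. (grad g has_derivative (\<lambda>v. H x *v v)) (at x)" and cont: "continuous_on UNIV H"
    using assms unfolding twice_continuously_differentiable_def by blast
  obtain A where A: "A > 0" "\<And>x. norm x \<le> R \<Longrightarrow> norm (H x) \<le> A"
    using continuous_bounded_on_cball[OF cont] by blast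
  \<comment> \<open>A crude estimate: the operator norm is at most the number of entries times a
    bound on each entry.\<close>
  have on: "onorm ((*v) (H x)) \<le> real CARD('n) * real CARD('n) * A" if "norm x \<le> R" for x
  proof (rule onorm_le_matrix_component)
    fix i j
    have "\<bar>H x $ i $ j\<bar> \<le> norm (H x $ i)" by (rule component_le_norm_cart)
    also have "\<dots> \<le> norm (H x)" by (rule Finite_Cartesian_Product.norm_nth_le)
    finally show "\<bar>H x $ i $ j\<bar> \<le> A" using A(2)[OF that] by linarith
  qed
  have "norm (grad g x - grad g y) \<le> real CARD('n) * real CARD('n) * A * norm (x - y)"
    if "norm x \<le> R" "norm y \<le> R" for x y
    by (rule differentiable_bound[of "cball 0 R" _ "\<lambda>x v. H x *v v"])
       (use H on that in \<open>auto intro: has_derivative_at_withinI\<close>)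
  moreover have "real CARD('n) * real CARD('n) * A > 0" using A(1) by simp
  ultimately show ?thesis using that by blast
qed

lemma gderiv_mean_value:
  fixes g :: "real ^ 'n \<Rightarrow> real"
  assumes "\<And>x. GDERIV g x :> D x"
  obtains t where "0 < t" "t < 1" "g (x + v) - g x = D (x + t *\<^sub>R v) \<bullet> v"
proof -
  have "((\<lambda>t::real. g (x + t *\<^sub>R v)) has_real_derivative D (x + t *\<^sub>R v) \<bullet> v) (at t)" for t
  proof -
    have "(g has_derivative (\<lambda>h. h \<bullet> D (x + t *\<^sub>R v))) (at (x + t *\<^sub>R v))"
      using assms by (simp add: gderiv_def)
    moreover have "((\<lambda>t::real. x + t *\<^sub>R v) has_derivative (\<lambda>t. t *\<^sub>R v)) (at t)"
      by (auto intro!: derivative_eq_intros)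
    ultimately have "(g \<circ> (\<lambda>t::real. x + t *\<^sub>R v) has_derivative
        (\<lambda>h. h \<bullet> D (x + t *\<^sub>R v)) \<circ> (\<lambda>t. t *\<^sub>R v)) (at t)"
      by (intro diff_chain_at) auto
    then show ?thesis
      by (simp add: has_field_derivative_def o_def inner_commute mult.commute[of _ "v \<bullet> _"])
  qed
  then obtain t :: real where "0 < t" "t < 1"
    "g (x + 1 *\<^sub>R v) - g (x + 0 *\<^sub>R v) = (1 - 0) * (D (x + t *\<^sub>R v) \<bullet> v)"
    using MVT2[of 0 1 "\<lambda>t. g (x + t *\<^sub>R v)" "\<lambda>t. D (x + t *\<^sub>R v) \<bullet> v"] by auto
  then show ?thesis using that by simp
qed

section \<open>The BFGS update\<close>

lemma columnvector_rowvector_mult: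
  fixes u w z :: "real ^ 'n"
  shows "(columnvector u :: real ^ 1 ^ 'n) *v ((rowvector w :: real ^ 'n ^ 1) *v z) = (w \<bullet> z) *\<^sub>R u"
  by (simp add: vec_eq_iff matrix_vector_mult_def columnvector_def rowvector_def inner_vec_def
      mult.commute)

text \<open>Applied to a vector, both rank-one matrices reduce to an inner product times a fixed
  vector. In this form symmetry and quadratic forms can be treated without matrix products.\<close>

lemma bfgs_update_mult:
  fixes B :: "real ^ 'n ^ 'n"
  shows "bfgs_update B s y *v z =
    B *v z - ((s \<bullet> (B *v z)) / (s \<bullet> (B *v s))) *\<^sub>R (B *v s) + ((y \<bullet> z) / (s \<bullet> y)) *\<^sub>R y"
proof -
  have "(B ** (columnvector s :: real ^ 1 ^ 'n) ** (rowvector s :: real ^ 'n ^ 1) ** B) *v z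
      = (s \<bullet> (B *v z)) *\<^sub>R (B *v s)"
    by (simp add: matrix_vector_mul_assoc[symmetric] columnvector_rowvector_mult
        matrix_vector_mult_scaleR)
  moreover have "((columnvector y :: real ^ 1 ^ 'n) ** (rowvector y :: real ^ 'n ^ 1)) *v z
      = (y \<bullet> z) *\<^sub>R y"
    by (simp add: matrix_vector_mul_assoc[symmetric] columnvector_rowvector_mult)
  ultimately show ?thesis
    by (simp add: bfgs_update_def matrix_vector_mult_add_rdistrib matrix_vector_mult_diff_rdistrib
        scaleR_matrix_vector_assoc[symmetric] divide_inverse mult.commute)
qed

text \<open>Symmetry must persist along the run, because it turns the subtracted term of the
  quadratic form into a square.\<close>

lemma bfgs_update_symmetric:
  fixes B :: "real ^ 'n ^ 'n"
  assumes sym: "\<And>u v. u \<bullet> (B *v v) = v \<bullet> (B *v u)"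
  shows "u \<bullet> (bfgs_update B s y *v v) = v \<bullet> (bfgs_update B s y *v u)"
  unfolding bfgs_update_mult
  using sym[of u v] sym[of u s] sym[of v s]
  by (simp add: inner_add_right inner_diff_right inner_commute mult.commute)

text \<open>The subtracted rank-one term is positive semidefinite, so one update raises the
  quadratic form by at most the added rank-one term.\<close>

lemma bfgs_update_quadratic_form_le:
  fixes B :: "real ^ 'n ^ 'n"
  assumes sym: "\<And>u v. u \<bullet> (B *v v) = v \<bullet> (B *v u)"
    and "s \<bullet> (B *v s) > 0" "s \<bullet> y > 0"
  shows "z \<bullet> (bfgs_update B s y *v z) \<le> z \<bullet> (B *v z) + (norm y)\<^sup>2 / (s \<bullet> y) * (norm z)\<^sup>2"
proof -
  have "z \<bullet> (bfgs_update B s y *v z) =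
      z \<bullet> (B *v z) - (s \<bullet> (B *v z))\<^sup>2 / (s \<bullet> (B *v s)) + (y \<bullet> z)\<^sup>2 / (s \<bullet> y)"
    unfolding bfgs_update_mult using sym[of z s]
    by (simp add: inner_add_right inner_diff_right inner_commute power2_eq_square)
  moreover have "(s \<bullet> (B *v z))\<^sup>2 / (s \<bullet> (B *v s)) \<ge> 0" using assms by simp
  moreover have "(y \<bullet> z)\<^sup>2 / (s \<bullet> y) \<le> (norm y)\<^sup>2 / (s \<bullet> y) * (norm z)\<^sup>2"
  proof -
    have "(y \<bullet> z)\<^sup>2 \<le> (norm y)\<^sup>2 * (norm z)\<^sup>2"
      using Cauchy_Schwarz_ineq[of y z] by (simp add: power2_norm_eq_inner)
    then show ?thesis using assms(3) by (simp add: divide_right_mono)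
  qed
  ultimately show ?thesis by linarith
qed

section \<open>Pareto optima of convex problems\<close>

text \<open>The nearer point \<open>p + a *\<^sub>R d\<close> is the convex combination of
  \<open>p\<close> and \<open>p + b *\<^sub>R d\<close> with weight \<open>a / b\<close> on the
  latter.\<close>

lemma convex_difference_quotient_mono:
  fixes f :: "real ^ 'n \<Rightarrow> real"
  assumes "convex_on UNIV f" "0 < a" "a \<le> b"
  shows "(f (p + a *\<^sub>R d) - f p) / a \<le> (f (p + b *\<^sub>R d) - f p) / b"
proof -
  have b: "b > 0" using assms by linarith
  have eq: "(1 - a / b) *\<^sub>R p + (a / b) *\<^sub>R (p + b *\<^sub>R d) = p + a *\<^sub>R d"
    using b by (simp add: algebra_simps)
  have "f (p + a *\<^sub>R d) \<le> (1 - a / b) * f p + (a / b) * f (p + b *\<^sub>R d)"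
    unfolding eq[symmetric] using assms by (intro convex_onD) auto
  then have "f (p + a *\<^sub>R d) - f p \<le> a * ((f (p + b *\<^sub>R d) - f p) / b)"
    by (simp add: algebra_simps diff_divide_distrib)
  then show ?thesis using assms by (simp add: pos_divide_le_eq mult.commute)
qed

text \<open>\<open>Lim\<close> carries information only once the limit is known to exist. The
  difference quotients are monotone in the step and nonnegative by \<open>ge\<close>, so they
  converge to their infimum, which is nonnegative.\<close>

lemma directional_derivative_nonneg:
  fixes f :: "real ^ 'n \<Rightarrow> real"
  assumes "convex_on UNIV f" and ge: "\<And>a. a > 0 \<Longrightarrow> f p \<le> f (p + a *\<^sub>R d)"
  shows "0 \<le> directional_derivative f p d"
proof -
  define q where "q a = (f (p + a *\<^sub>R d) - f p) / a" for a :: real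
  have q0: "0 \<le> q a" if "a > 0" for a using ge[OF that] that by (simp add: q_def)
  have bdd: "bdd_below (q ` {0<..})" using q0 by (intro bdd_belowI[of _ 0]) auto
  have lim: "(q \<longlongrightarrow> Inf (q ` {0<..})) (at_right 0)"
  proof (rule order_tendstoI)
    fix c assume c: "c < Inf (q ` {0<..})"
    have "c < q a" if "a > 0" for a
      using c cInf_lower[OF _ bdd, of "q a"] that by fastforce
    then show "\<forall>\<^sub>F a in at_right 0. c < q a"
      by (auto simp: eventually_at_right_field intro!: exI[of _ 1])
  next
    fix c assume "Inf (q ` {0<..}) < c"
    then obtain b where b: "b > 0" "q b < c"
      using cInf_less_iff[OF _ bdd] by auto
    have "q a < c" if "0 < a" "a < b" for a
      using convex_difference_quotient_mono[OF assms(1), of a b p d] that b by (simp add: q_def)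
    then show "\<forall>\<^sub>F a in at_right 0. q a < c"
      using b by (auto simp: eventually_at_right_field)
  qed
  have "directional_derivative f p d = Inf (q ` {0<..})"
    unfolding directional_derivative_def q_def[symmetric]
    by (rule tendsto_Lim[OF trivial_limit_at_right_real lim])
  then show ?thesis
    using q0 by (auto intro!: cInf_greatest)
qed

text \<open>Some single objective never drops below its value at \<open>p\<close> along the ray.
  Otherwise each objective drops at some step of its own, and by monotone difference quotients the
  smallest of these finitely many steps lowers all of them at once, against optimality.\<close>

lemma pareto_optimum_imp_stationary:
  fixes F :: "real ^ 'n \<Rightarrow> real ^ 'm"
  assumes conv: "\<And>i. convex_on UNIV (\<lambda>z. F z $ i)" and opt: "pareto_optimum F p"
  shows "pareto_stationary F p"
  unfolding pareto_stationary_def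
proof
  fix d
  have "\<exists>i. \<forall>a>0. F p $ i \<le> F (p + a *\<^sub>R d) $ i"
  proof (rule ccontr)
    assume "\<not> ?thesis"
    then have "\<forall>i. \<exists>a>0. F (p + a *\<^sub>R d) $ i < F p $ i" by (meson not_le)
    then obtain a where a: "\<And>i. a i > 0" "\<And>i. F (p + a i *\<^sub>R d) $ i < F p $ i" by metis
    define c where "c = Min (range a)"
    have c: "c > 0" "\<And>i. c \<le> a i" using a(1) by (auto simp: c_def)
    have less: "F (p + c *\<^sub>R d) $ i < F p $ i" for i
    proof -
      have "(F (p + c *\<^sub>R d) $ i - F p $ i) / c \<le> (F (p + a i *\<^sub>R d) $ i - F p $ i) / a i"
        by (rule convex_difference_quotient_mono[OF conv c])
      also have "\<dots> < 0" using a[of i] by (simp add: divide_neg_pos)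
      finally show ?thesis using c by (simp add: divide_less_0_iff)
    qed
    \<comment> \<open>Any one component separates the two vectors; \<open>undefined\<close> serves
      as an arbitrary index.\<close>
    then have "F (p + c *\<^sub>R d) \<le> F p" "F (p + c *\<^sub>R d) \<noteq> F p"
      using less_irrefl[of "F p $ undefined"] less[of undefined]
      by (auto simp: less_eq_vec_def less_imp_le)
    then show False using opt unfolding pareto_optimum_def by blast
  qed
  then obtain i where "\<And>a. a > 0 \<Longrightarrow> F p $ i \<le> F (p + a *\<^sub>R d) $ i" by blast
  then have "0 \<le> directional_derivative (\<lambda>z. F z $ i) p d"
    by (intro directional_derivative_nonneg conv)
  also have "\<dots> \<le> (MAX i. directional_derivative (\<lambda>z. F z $ i) p d)"
    by (intro Max_ge) auto
  finally show "0 \<le> (MAX i. directional_derivative (\<lambda>z. F z $ i) p d)" .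
qed

section \<open>Runs of the algorithm\<close>

text \<open>Used to replace constants that depend on the objective by their maximum.\<close>

lemma finite_uniform_bound:
  fixes P :: "'m::finite \<Rightarrow> real \<Rightarrow> bool"
  assumes "\<And>i. \<exists>A>0. P i A" and mono: "\<And>i a b. P i a \<Longrightarrow> a \<le> b \<Longrightarrow> P i b"
  obtains A where "A > 0" "\<And>i. P i A"
proof -
  obtain a where a: "\<And>i. a i > 0" "\<And>i. P i (a i)" using assms(1) by metis
  have "a i \<le> Max (range a)" for i by (intro Max_ge) auto
  moreover from this have "Max (range a) > 0" using a(1) less_le_trans by blast
  ultimately show ?thesis using that a(2) mono by blast
qed

locale bfgs_run =
  fixes g h :: "'m::finite \<Rightarrow> real ^ 'n \<Rightarrow> real"
    and \<rho> \<zeta> \<sigma> :: real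
    and x d :: "nat \<Rightarrow> real ^ 'n"
    and B :: "nat \<Rightarrow> 'm \<Rightarrow> real ^ 'n ^ 'n"
    and \<alpha> l :: "nat \<Rightarrow> real"
  assumes g_C2: "\<And>i. twice_continuously_differentiable (g i)"
    and g_strongly_convex: "\<And>i. strongly_convex (g i)"
    and h_convex: "\<And>i. convex_on UNIV (h i)"
    and rho: "0 < \<rho>" "\<rho> < 1"
    and zeta: "0 < \<zeta>" "\<zeta> < 1"
    and run: "infinite_bfgs_run g h \<rho> \<zeta> x B d \<alpha> l"
    and sigma: "\<sigma> > 0"
    and B_bound: "\<And>z k i. \<sigma> * (norm z)\<^sup>2 \<le> z \<bullet> (B k i *v z)"
begin

section \<open>Basic properties of the subproblem and the line search\<close>

abbreviation f :: "'m \<Rightarrow> real ^ 'n \<Rightarrow> real" where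
  "f i z \<equiv> g i z + h i z"

lemma gderiv_grad: "GDERIV (g i) z :> grad (g i) z"
  using g_C2 unfolding twice_continuously_differentiable_def by blast

lemma f_strongly_convex: "strongly_convex (f i)"
  by (rule strongly_convex_add_convex[OF g_strongly_convex h_convex])

lemma f_convex: "convex_on UNIV (f i)"
  by (rule strongly_convex_imp_convex[OF f_strongly_convex])

lemma alpha_le_subproblem: "\<alpha> k \<le> subproblem g h (B k) (x k) e"
proof -
  have "is_arg_min (subproblem g h (B k) (x k)) (\<lambda>_. True) (d k)"
    and "\<alpha> k = subproblem g h (B k) (x k) (d k)"
    using run unfolding infinite_bfgs_run_def by blast+
  then show ?thesis by (simp add: is_arg_min_linorder)
qed

text \<open>Every trial direction bounds the optimal value from above. The trial direction 0 gives
  \<open>\<alpha> k \<le> 0\<close>; a short move towards a better point gives the quantitative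
  bound behind the final contradiction.\<close>

lemma alpha_leI:
  assumes "\<And>i. grad (g i) (x k) \<bullet> e + 1 / 2 * (e \<bullet> (B k i *v e)) + h i (x k + e) - h i (x k) \<le> c"
  shows "\<alpha> k \<le> c"
proof -
  have "subproblem g h (B k) (x k) e \<le> c"
    unfolding subproblem_def using assms by (intro Max.boundedI) auto
  then show ?thesis using alpha_le_subproblem[of k e] by linarith
qed

lemma alpha_ge:
  "grad (g i) (x k) \<bullet> d k + 1 / 2 * (d k \<bullet> (B k i *v d k)) + h i (x k + d k) - h i (x k) \<le> \<alpha> k"
proof -
  have "\<alpha> k = subproblem g h (B k) (x k) (d k)"
    using run unfolding infinite_bfgs_run_def by blast
  then show ?thesis
    unfolding subproblem_def by (auto intro!: Max_ge)
qed

lemma alpha_nonpos: "\<alpha> k \<le> 0"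
  using alpha_leI[of k 0 0] by simp

lemma step_in_armijo: "l k \<in> armijo_steps \<rho> \<zeta> (\<lambda>z. \<chi> i. f i z) (x k) (d k) (\<alpha> k)"
  and step_maximal: "t \<in> armijo_steps \<rho> \<zeta> (\<lambda>z. \<chi> i. f i z) (x k) (d k) (\<alpha> k) \<Longrightarrow> t \<le> l k"
  and x_Suc: "x (Suc k) = x k + l k *\<^sub>R d k"
  and d_nonzero: "d k \<noteq> 0"
  and B_Suc: "B (Suc k) i =
    bfgs_update (B k i) (x (Suc k) - x k) (grad (g i) (x (Suc k)) - grad (g i) (x k))"
  using run unfolding infinite_bfgs_run_def Let_def by blast+

lemma step_pos: "0 < l k"
  using step_in_armijo[of k] zeta unfolding armijo_steps_def by auto

lemma descent: "f i (x (Suc k)) \<le> f i (x k) + l k * \<rho> * \<alpha> k"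
  using step_in_armijo[of k] unfolding armijo_steps_def x_Suc by auto

lemma f_antimono: "antimono (\<lambda>k. f i (x k))"
proof (rule decseq_SucI)
  fix k
  have "l k * \<rho> * \<alpha> k \<le> 0"
    using step_pos[of k] rho alpha_nonpos[of k] by (simp add: mult_nonneg_nonpos)
  then show "f i (x (Suc k)) \<le> f i (x k)" using descent[of i k] by linarith
qed

section \<open>Boundedness of iterates and directions\<close>

lemma iterates_bounded:
  obtains R where "R > 0" "\<And>k. norm (x k) \<le> R"
proof -
  \<comment> \<open>One objective, here with the arbitrary index \<open>undefined\<close>, is
    enough: its values decrease, so all iterates lie in one of its bounded sublevel sets.\<close>
  have "bounded {z. f undefined z \<le> f undefined (x 0)}"
    by (rule strongly_convex_bounded_sublevel[OF f_strongly_convex])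
  moreover have "f undefined (x k) \<le> f undefined (x 0)" for k
    using decseqD[OF f_antimono] by blast
  ultimately show ?thesis
    using that unfolding bounded_pos by blast
qed

text \<open>The model value at \<open>d k\<close> is at most 0 and contains a quadratic term of at
  least \<open>\<sigma> / 2 * (norm (d k))\<^sup>2\<close>. The other terms fall at most linearly in
  \<open>norm (d k)\<close>: for \<open>h i\<close>, convexity compares the full step with the step
  of length 1, which ends in a ball where \<open>h i\<close> is bounded.\<close>

lemma directions_bounded:
  obtains D where "D > 0" "\<And>k. norm (d k) \<le> D"
proof -
  fix i :: 'm
  obtain R where R: "\<And>k. norm (x k) \<le> R" using iterates_bounded by blast
  obtain A where A: "A > 0" "\<And>z. norm z \<le> R + 1 \<Longrightarrow> norm (h i z) \<le> A"
    using continuous_bounded_on_cball[OF convex_continuous_on_UNIV[OF h_convex]] by blast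
  have "continuous_on UNIV (grad (g i))"
    using g_C2[of i] unfolding twice_continuously_differentiable_def
    by (meson continuous_at_imp_continuous_on has_derivative_continuous)
  then obtain G where G: "G > 0" "\<And>z. norm z \<le> R \<Longrightarrow> norm (grad (g i) z) \<le> G"
    using continuous_bounded_on_cball by blast
  have "norm (d k) \<le> 1 + 2 * (G + 2 * A) / \<sigma>" for k
  proof (cases "norm (d k) \<le> 1")
    case True
    have "0 \<le> 2 * (G + 2 * A) / \<sigma>" using A(1) G(1) sigma by simp
    then show ?thesis using True by linarith
  next
    case False
    define t where "t = 1 / norm (d k)"
    have t: "0 < t" "t < 1" "t * norm (d k) = 1"
      using False by (auto simp: t_def divide_less_eq_1 not_le simp del: zero_less_norm_iff)
    have "(1 - t) *\<^sub>R x k + t *\<^sub>R (x k + d k) = x k + t *\<^sub>R d k" by (simp add: algebra_simps)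
    then have "h i (x k + t *\<^sub>R d k) \<le> (1 - t) * h i (x k) + t * h i (x k + d k)"
      using convex_onD[OF h_convex, of t "x k" "x k + d k" i] t by simp
    moreover have "norm (x k + t *\<^sub>R d k) \<le> R + 1"
      using norm_triangle_ineq[of "x k" "t *\<^sub>R d k"] R[of k] t by simp
    then have "- A \<le> h i (x k + t *\<^sub>R d k)" using A(2)[of "x k + t *\<^sub>R d k"] by simp
    moreover have "h i (x k) \<le> A" using A(2)[of "x k"] R[of k] by simp
    ultimately have 1: "- 2 * A \<le> t * (h i (x k + d k) - h i (x k))"
      by (simp add: algebra_simps)
    have "\<bar>grad (g i) (x k) \<bullet> (t *\<^sub>R d k)\<bar> \<le> norm (grad (g i) (x k)) * norm (t *\<^sub>R d k)"
      by (rule Cauchy_Schwarz_ineq2)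
    then have 2: "- G \<le> t * (grad (g i) (x k) \<bullet> d k)"
      using G(2)[OF R, of k] t by simp
    have "grad (g i) (x k) \<bullet> d k + 1 / 2 * (\<sigma> * (norm (d k))\<^sup>2) + (h i (x k + d k) - h i (x k)) \<le> 0"
      using alpha_ge[of i k] alpha_nonpos[of k] B_bound[of "d k" k i] by linarith
    then have "t * (grad (g i) (x k) \<bullet> d k + 1 / 2 * (\<sigma> * (norm (d k))\<^sup>2)
        + (h i (x k + d k) - h i (x k))) \<le> 0"
      using t by (simp add: mult_nonneg_nonpos)
    moreover have "t * (1 / 2 * (\<sigma> * (norm (d k))\<^sup>2)) = 1 / 2 * \<sigma> * norm (d k)"
      using t(3) by (simp add: power2_eq_square algebra_simps)
    ultimately have "1 / 2 * \<sigma> * norm (d k) \<le> G + 2 * A"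
      using 1 2 unfolding distrib_left by linarith
    then have "norm (d k) \<le> 2 * (G + 2 * A) / \<sigma>" using sigma by (simp add: field_simps)
    then show ?thesis by linarith
  qed
  moreover have "1 + 2 * (G + 2 * A) / \<sigma> > 0" using A(1) G(1) sigma by (simp add: add_pos_nonneg)
  ultimately show ?thesis using that by blast
qed

lemma gradients_lipschitz:
  obtains L where "L > 0" "\<And>i u v. norm u \<le> R \<Longrightarrow> norm v \<le> R \<Longrightarrow>
    norm (grad (g i) u - grad (g i) v) \<le> L * norm (u - v)"
proof -
  define P where "P i L \<longleftrightarrow> (\<forall>u v. norm u \<le> R \<longrightarrow> norm v \<le> R \<longrightarrow>
    norm (grad (g i) u - grad (g i) v) \<le> L * norm (u - v))" for i L
  have "\<exists>L>0. P i L" for i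
    using twice_continuously_differentiable_grad_lipschitz[OF g_C2, where R = R]
    unfolding P_def by metis
  moreover have "P i b" if "P i a" "a \<le> b" for i a b
    using that unfolding P_def by (meson mult_right_mono norm_ge_zero order_trans)
  ultimately obtain L where "L > 0" "\<And>i. P i L" using finite_uniform_bound[of P] by blast
  then show ?thesis using that unfolding P_def by blast
qed

section \<open>Step sizes and summability of the optimal values\<close>

text \<open>The lower bound on the matrices makes every step below a fixed multiple of
  \<open>\<sigma> / L\<close> admissible, however large the matrices become.\<close>

lemma step_bounded_below:
  obtains c where "c > 0" "\<And>k. c \<le> l k"
proof -
  obtain R where R: "R > 0" "\<And>k. norm (x k) \<le> R" using iterates_bounded by blast
  obtain D where D: "D > 0" "\<And>k. norm (d k) \<le> D" using directions_bounded by blast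
  obtain L where L: "L > 0" "\<And>i u v. norm u \<le> R + D \<Longrightarrow> norm v \<le> R + D \<Longrightarrow>
    norm (grad (g i) u - grad (g i) v) \<le> L * norm (u - v)" using gradients_lipschitz by blast
  \<comment> \<open>The step \<open>\<zeta> ^ j\<close> is so short that the change of the gradient
    along it contributes at most \<open>\<sigma> / 2 * (norm (d k))\<^sup>2\<close>, which the
    quadratic term of the model dominates.\<close>
  obtain j where j: "\<zeta> ^ j < \<sigma> / (2 * L)"
    using real_arch_pow_inv[of "\<sigma> / (2 * L)" \<zeta>] zeta sigma L(1) by auto
  define s where "s = \<zeta> ^ j"
  have s: "0 < s" "s \<le> 1" "L * s \<le> \<sigma> / 2"
    using zeta j L(1) by (auto simp: s_def power_le_one field_simps)
  have "f i (x k + s *\<^sub>R d k) \<le> f i (x k) + s * \<rho> * \<alpha> k" for i k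
  proof -
    obtain t where t: "0 < t" "t < 1"
      "g i (x k + s *\<^sub>R d k) - g i (x k) = grad (g i) (x k + t *\<^sub>R s *\<^sub>R d k) \<bullet> (s *\<^sub>R d k)"
      using gderiv_mean_value[OF gderiv_grad] by blast
    have ts: "t * s \<le> 1" "t * s \<le> s" using t s by (auto simp: mult_le_one mult_left_le_one_le)
    have ts0: "0 \<le> t * s" using t s by simp
    have "norm (t *\<^sub>R s *\<^sub>R d k) \<le> D"
    proof -
      have "norm (t *\<^sub>R s *\<^sub>R d k) = (t * s) * norm (d k)" using t s by simp
      also have "\<dots> \<le> norm (d k)" using ts ts0 by (simp add: mult_left_le_one_le)
      finally show ?thesis using D(2)[of k] by linarith
    qed
    then have nrm: "norm (x k + t *\<^sub>R s *\<^sub>R d k) \<le> R + D"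
      using norm_triangle_ineq[of "x k" "t *\<^sub>R s *\<^sub>R d k"] R(2)[of k] by linarith
    have "norm (grad (g i) (x k + t *\<^sub>R s *\<^sub>R d k) - grad (g i) (x k)) \<le> L * norm (t *\<^sub>R s *\<^sub>R d k)"
      using L(2)[OF nrm, of "x k" i] R(2)[of k] D(1) by simp
    also have "\<dots> \<le> L * (s * norm (d k))"
    proof -
      have "norm (t *\<^sub>R s *\<^sub>R d k) = (t * s) * norm (d k)" using t s by simp
      also have "\<dots> \<le> s * norm (d k)" using ts by (intro mult_right_mono) auto
      finally show ?thesis using L(1) by simp
    qed
    finally have gr: "norm (grad (g i) (x k + t *\<^sub>R s *\<^sub>R d k) - grad (g i) (x k))
        \<le> L * (s * norm (d k))" .
    have "(grad (g i) (x k + t *\<^sub>R s *\<^sub>R d k) - grad (g i) (x k)) \<bullet> d k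
        \<le> norm (grad (g i) (x k + t *\<^sub>R s *\<^sub>R d k) - grad (g i) (x k)) * norm (d k)"
      by (rule norm_cauchy_schwarz)
    also have "\<dots> \<le> L * (s * norm (d k)) * norm (d k)"
      by (intro mult_right_mono gr) auto
    also have "\<dots> = (L * s) * (norm (d k))\<^sup>2" by (simp add: power2_eq_square)
    also have "\<dots> \<le> \<sigma> / 2 * (norm (d k))\<^sup>2" using s by (intro mult_right_mono) auto
    finally have 1: "grad (g i) (x k + t *\<^sub>R s *\<^sub>R d k) \<bullet> d k
        \<le> grad (g i) (x k) \<bullet> d k + \<sigma> / 2 * (norm (d k))\<^sup>2"
      by (simp add: inner_diff_left)
    have "(1 - s) *\<^sub>R x k + s *\<^sub>R (x k + d k) = x k + s *\<^sub>R d k" by (simp add: algebra_simps)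
    then have 2: "h i (x k + s *\<^sub>R d k) - h i (x k) \<le> s * (h i (x k + d k) - h i (x k))"
      using convex_onD[OF h_convex, of s "x k" "x k + d k" i] s by (simp add: algebra_simps)
    have "f i (x k + s *\<^sub>R d k) - f i (x k)
        \<le> s * (grad (g i) (x k + t *\<^sub>R s *\<^sub>R d k) \<bullet> d k + (h i (x k + d k) - h i (x k)))"
      using t(3) 2 by (simp add: distrib_left)
    also have "\<dots> \<le> s * \<alpha> k"
      using 1 alpha_ge[of i k] B_bound[of "d k" k i] s(1) by (intro mult_left_mono) auto
    \<comment> \<open>As \<open>\<alpha> k\<close> is nonpositive, multiplying it by
      \<open>\<rho> < 1\<close> can only increase it.\<close>
    also have "\<dots> \<le> s * (\<rho> * \<alpha> k)"
      using alpha_nonpos[of k] rho s(1) by (intro mult_left_mono) (auto simp: mult_le_cancel_right1)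
    finally show ?thesis by simp
  qed
  then have "s \<in> armijo_steps \<rho> \<zeta> (\<lambda>z. \<chi> i. f i z) (x k) (d k) (\<alpha> k)" for k
    unfolding armijo_steps_def s_def by auto
  then have "s \<le> l k" for k using step_maximal by blast
  then show ?thesis using that s(1) by blast
qed

text \<open>With steps of at least \<open>c\<close>, each iteration lowers \<open>f i\<close> by at
  least \<open>c * \<rho> * - \<alpha> k\<close>. These decreases telescope, and their total is
  bounded by the lower bound on the values.\<close>

lemma summable_alpha:
  assumes "bdd_below (range (\<lambda>k. f i (x k)))"
  shows "summable \<alpha>"
proof -
  obtain c where c: "c > 0" "\<And>k. c \<le> l k" using step_bounded_below by blast
  obtain m where m: "\<And>k. m \<le> f i (x k)" using assms unfolding bdd_below_def by auto
  have step: "c * \<rho> * - \<alpha> k \<le> f i (x k) - f i (x (Suc k))" for k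
  proof -
    have "c * \<rho> * - \<alpha> k \<le> l k * \<rho> * - \<alpha> k"
      using c(2) rho alpha_nonpos by (intro mult_right_mono) auto
    then show ?thesis using descent[of i k] by simp
  qed
  have "(\<Sum>k<N. - \<alpha> k) \<le> (f i (x 0) - m) / (c * \<rho>)" for N
  proof -
    have "c * \<rho> * (\<Sum>k<N. - \<alpha> k) \<le> (\<Sum>k<N. f i (x k) - f i (x (Suc k)))"
      unfolding sum_distrib_left by (intro sum_mono step)
    also have "\<dots> = f i (x 0) - f i (x N)" by (rule sum_lessThan_telescope')
    also have "\<dots> \<le> f i (x 0) - m" using m[of N] by linarith
    finally show ?thesis using c(1) rho by (simp add: field_simps)
  qed
  then have "summable (\<lambda>k. - \<alpha> k)"
    using alpha_nonpos by (intro summableI_nonneg_bounded) auto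
  then show ?thesis by (simp add: summable_minus_iff)
qed

section \<open>Linear growth of the BFGS matrices\<close>

lemma B_symmetric: "u \<bullet> (B k i *v v) = v \<bullet> (B k i *v u)"
proof (induction k arbitrary: u v)
  case 0
  have "transpose (B 0 i) = B 0 i"
    using run unfolding infinite_bfgs_run_def symmetric_positive_definite_def by blast
  then show ?case by (metis dot_lmul_matrix inner_commute vector_transpose_matrix)
next
  case (Suc k)
  then show ?case unfolding B_Suc by (rule bfgs_update_symmetric)
qed

text \<open>One update adds at most \<open>(norm y)\<^sup>2 / (s \<bullet> y)\<close> times
  \<open>(norm z)\<^sup>2\<close>. The Lipschitz gradient gives
  \<open>norm y \<le> L * norm s\<close> and strong monotonicity gives
  \<open>s \<bullet> y \<ge> \<eta> * (norm s)\<^sup>2\<close>, so this ratio never exceeds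
  \<open>L\<^sup>2 / \<eta>\<close>.\<close>

lemma quadratic_form_linear_growth_component:
  "\<exists>b>0. \<forall>k z. z \<bullet> (B k i *v z) \<le> b * real (Suc k) * (norm z)\<^sup>2"
proof -
  obtain R where R: "R > 0" "\<And>k. norm (x k) \<le> R" using iterates_bounded by blast
  obtain L where L: "L > 0" "\<And>i u v. norm u \<le> R \<Longrightarrow> norm v \<le> R \<Longrightarrow>
    norm (grad (g i) u - grad (g i) v) \<le> L * norm (u - v)" using gradients_lipschitz by blast
  obtain \<eta> where \<eta>: "\<eta> > 0" and sc: "\<And>x y t. t \<in> {0..1} \<Longrightarrow> g i (t *\<^sub>R x + (1 - t) *\<^sub>R y)
      \<le> t * g i x + (1 - t) * g i y - 1 / 2 * t * (1 - t) * \<eta> * (norm (x - y))\<^sup>2"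
    using g_strongly_convex[of i] unfolding strongly_convex_def by blast
  \<comment> \<open>The first entry of the maximum covers the initial matrix, the second each
    increment. After \<open>k\<close> updates this makes \<open>k + 1\<close> contributions, hence
    the factor \<open>Suc k\<close>.\<close>
  define b where "b = max (onorm ((*v) (B 0 i))) (L\<^sup>2 / \<eta>)"
  have b: "b > 0" using L(1) \<eta> by (simp add: b_def less_max_iff_disj)
  have "z \<bullet> (B k i *v z) \<le> b * real (Suc k) * (norm z)\<^sup>2" for k z
  proof (induction k arbitrary: z)
    case 0
    have "z \<bullet> (B 0 i *v z) \<le> norm z * norm (B 0 i *v z)" by (rule norm_cauchy_schwarz)
    also have "\<dots> \<le> norm z * (onorm ((*v) (B 0 i)) * norm z)"
      by (intro mult_left_mono onorm matrix_vector_mul_bounded_linear) auto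
    also have "\<dots> = onorm ((*v) (B 0 i)) * (norm z)\<^sup>2" by (simp add: power2_eq_square)
    also have "\<dots> \<le> b * (norm z)\<^sup>2" by (intro mult_right_mono) (auto simp: b_def)
    finally show ?case by simp
  next
    case (Suc k)
    define s where "s = x (Suc k) - x k"
    define y where "y = grad (g i) (x (Suc k)) - grad (g i) (x k)"
    have s0: "s \<noteq> 0" using x_Suc[of k] step_pos[of k] d_nonzero[of k] by (simp add: s_def)
    have sy: "\<eta> * (norm s)\<^sup>2 \<le> s \<bullet> y"
      unfolding s_def y_def
      by (rule strongly_convex_gradient_monotone[OF sc gderiv_grad gderiv_grad])
    have sy0: "s \<bullet> y > 0" using sy \<eta> s0 by (smt (verit) mult_pos_pos zero_less_norm_iff zero_less_power)
    have sBs: "s \<bullet> (B k i *v s) > 0"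
      using B_bound[of s k i] sigma s0 by (smt (verit) mult_pos_pos zero_less_norm_iff zero_less_power)
    have "norm y \<le> L * norm s" unfolding y_def s_def by (intro L(2) R(2))
    then have "(norm y)\<^sup>2 \<le> (L * norm s)\<^sup>2" by (intro power_mono) auto
    also have "\<dots> = L\<^sup>2 / \<eta> * (\<eta> * (norm s)\<^sup>2)" using \<eta> by (simp add: power_mult_distrib)
    also have "\<dots> \<le> L\<^sup>2 / \<eta> * (s \<bullet> y)" using sy \<eta> by (intro mult_left_mono) auto
    also have "\<dots> \<le> b * (s \<bullet> y)" using sy0 by (intro mult_right_mono) (auto simp: b_def)
    finally have ys: "(norm y)\<^sup>2 / (s \<bullet> y) \<le> b" using sy0 by (simp add: field_simps)
    have "z \<bullet> (B (Suc k) i *v z) \<le> z \<bullet> (B k i *v z) + (norm y)\<^sup>2 / (s \<bullet> y) * (norm z)\<^sup>2"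
      unfolding B_Suc s_def[symmetric] y_def[symmetric]
      by (rule bfgs_update_quadratic_form_le[OF B_symmetric sBs sy0])
    also have "\<dots> \<le> b * real (Suc k) * (norm z)\<^sup>2 + b * (norm z)\<^sup>2"
      by (intro add_mono Suc.IH mult_right_mono ys) auto
    finally show ?case by (simp add: algebra_simps)
  qed
  then show ?thesis using b by blast
qed

lemma quadratic_form_linear_growth:
  obtains b where "b > 0" "\<And>k i z. z \<bullet> (B k i *v z) \<le> b * real (Suc k) * (norm z)\<^sup>2"
proof -
  define P where "P i b \<longleftrightarrow> (\<forall>k z. z \<bullet> (B k i *v z) \<le> b * real (Suc k) * (norm z)\<^sup>2)" for i b
  have "P i b" if "P i a" "a \<le> b" for i a b
    unfolding P_def
  proof (intro allI)
    fix k z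
    have "z \<bullet> (B k i *v z) \<le> a * real (Suc k) * (norm z)\<^sup>2" using that(1) unfolding P_def by blast
    also have "\<dots> \<le> b * real (Suc k) * (norm z)\<^sup>2" using that(2) by (intro mult_right_mono) auto
    finally show "z \<bullet> (B k i *v z) \<le> b * real (Suc k) * (norm z)\<^sup>2" .
  qed
  moreover have "\<exists>b>0. P i b" for i
    using quadratic_form_linear_growth_component unfolding P_def .
  ultimately obtain b where "b > 0" "\<And>i. P i b" using finite_uniform_bound[of P] by blast
  then show ?thesis using that unfolding P_def by blast
qed

text \<open>The trial direction \<open>t *\<^sub>R (w - x k)\<close> gains at least
  \<open>t * \<epsilon>\<close> from the gradient and \<open>h i\<close>, while the quadratic term
  costs at most order \<open>t\<^sup>2 * (k + 1)\<close>. With \<open>t\<close> of order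
  \<open>1 / (k + 1)\<close> half of the gain survives, so \<open>- \<alpha> k\<close> dominates a
  multiple of the harmonic series although it is summable.\<close>

lemma not_uniformly_improvable:
  assumes bdd: "\<And>i. bdd_below (range (\<lambda>k. f i (x k)))" and \<epsilon>: "\<epsilon> > 0"
  shows "\<not> (\<forall>k i. f i w + \<epsilon> \<le> f i (x k))"
proof
  assume less: "\<forall>k i. f i w + \<epsilon> \<le> f i (x k)"
  obtain R where R: "R > 0" "\<And>k. norm (x k) \<le> R" using iterates_bounded by blast
  obtain b where b: "b > 0" "\<And>k i z. z \<bullet> (B k i *v z) \<le> b * real (Suc k) * (norm z)\<^sup>2"
    using quadratic_form_linear_growth by blast
  define E where "E = R + norm w"
  have E: "E > 0" using R(1) by (simp add: E_def add_pos_nonneg)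
  \<comment> \<open>The bound 1 keeps \<open>t = c / real (Suc k)\<close> within the range where
    convexity applies. The other bound limits \<open>t * (v \<bullet> (B k i *v v))\<close> to
    \<open>\<epsilon>\<close>, since \<open>E\<close> bounds the distance from the iterates to
    \<open>w\<close>.\<close>
  define c where "c = min 1 (\<epsilon> / (b * E\<^sup>2))"
  have c: "0 < c" "c \<le> 1" "c * (b * E\<^sup>2) \<le> \<epsilon>"
  proof -
    have "b * E\<^sup>2 > 0" using b(1) E by simp
    moreover have "c \<le> \<epsilon> / (b * E\<^sup>2)" by (simp add: c_def)
    ultimately show "c * (b * E\<^sup>2) \<le> \<epsilon>" by (simp add: pos_le_divide_eq)
  qed (use \<epsilon> b(1) E in \<open>auto simp: c_def\<close>)
  have alpha: "\<epsilon> * c / 2 * inverse (real (Suc k)) \<le> - \<alpha> k" for k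
  proof -
    define v where "v = w - x k"
    define t where "t = c / real (Suc k)"
    have t: "0 < t" "t \<le> 1" "t * (b * real (Suc k) * E\<^sup>2) \<le> \<epsilon>"
    proof -
      show "0 < t" "t \<le> 1" using c by (auto simp: t_def field_simps)
      have "t * real (Suc k) = c" by (simp add: t_def del: of_nat_Suc)
      then have "t * (b * real (Suc k) * E\<^sup>2) = c * (b * E\<^sup>2)" by (metis mult.assoc mult.left_commute)
      then show "t * (b * real (Suc k) * E\<^sup>2) \<le> \<epsilon>" using c(3) by linarith
    qed
    have v: "norm v \<le> E"
      using norm_triangle_ineq4[of w "x k"] R(2)[of k] by (simp add: v_def E_def)
    have "\<alpha> k \<le> - (t * \<epsilon> / 2)"
    proof (rule alpha_leI[where e = "t *\<^sub>R v"])
      fix i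
      obtain \<eta> where \<eta>: "\<eta> > 0" and sc: "\<And>x y t. t \<in> {0..1} \<Longrightarrow> g i (t *\<^sub>R x + (1 - t) *\<^sub>R y)
          \<le> t * g i x + (1 - t) * g i y - 1 / 2 * t * (1 - t) * \<eta> * (norm (x - y))\<^sup>2"
        using g_strongly_convex[of i] unfolding strongly_convex_def by blast
      have "grad (g i) (x k) \<bullet> (w - x k) \<le> g i w - g i (x k) - 1 / 2 * \<eta> * (norm (w - x k))\<^sup>2"
        by (rule strongly_convex_gradient_inequality[OF sc gderiv_grad])
      moreover have "0 \<le> 1 / 2 * \<eta> * (norm (w - x k))\<^sup>2" using \<eta> by simp
      ultimately have 1: "grad (g i) (x k) \<bullet> v \<le> g i w - g i (x k)"
        unfolding v_def by linarith
      have "(1 - t) *\<^sub>R x k + t *\<^sub>R w = x k + t *\<^sub>R v" by (simp add: v_def algebra_simps)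
      then have 2: "h i (x k + t *\<^sub>R v) - h i (x k) \<le> t * (h i w - h i (x k))"
        using convex_onD[OF h_convex, of t "x k" w i] t by (simp add: algebra_simps)
      have "v \<bullet> (B k i *v v) \<le> b * real (Suc k) * (norm v)\<^sup>2" by (rule b(2))
      also have "\<dots> \<le> b * real (Suc k) * E\<^sup>2"
        using v b(1) by (intro mult_left_mono power_mono) auto
      finally have "t * (v \<bullet> (B k i *v v)) \<le> t * (b * real (Suc k) * E\<^sup>2)"
        using t(1) by (intro mult_left_mono) auto
      then have 3: "t * (v \<bullet> (B k i *v v)) \<le> \<epsilon>" using t(3) by linarith
      have "grad (g i) (x k) \<bullet> (t *\<^sub>R v) + 1 / 2 * ((t *\<^sub>R v) \<bullet> (B k i *v (t *\<^sub>R v)))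
          + h i (x k + t *\<^sub>R v) - h i (x k)
        \<le> t * (grad (g i) (x k) \<bullet> v + 1 / 2 * (t * (v \<bullet> (B k i *v v))) + (h i w - h i (x k)))"
        using 2 by (simp add: matrix_vector_mult_scaleR algebra_simps)
      \<comment> \<open>The first-order part is at most \<open>- \<epsilon>\<close>, and the
        quadratic part gives back at most \<open>\<epsilon> / 2\<close>.\<close>
      also have "\<dots> \<le> t * (- \<epsilon> / 2)"
        using 1 3 less[rule_format, of i k] t(1) by (intro mult_left_mono) auto
      finally show "grad (g i) (x k) \<bullet> (t *\<^sub>R v) + 1 / 2 * ((t *\<^sub>R v) \<bullet> (B k i *v (t *\<^sub>R v)))
          + h i (x k + t *\<^sub>R v) - h i (x k) \<le> - (t * \<epsilon> / 2)" by simp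
    qed
    moreover have "\<epsilon> * c / 2 * inverse (real (Suc k)) = t * \<epsilon> / 2"
      unfolding t_def divide_inverse by (simp only: mult_ac)
    ultimately show ?thesis by linarith
  qed
  have "summable (\<lambda>k. - \<alpha> k)"
    using summable_alpha[OF bdd] by (simp add: summable_minus_iff)
  then have "summable (\<lambda>k. \<epsilon> * c / 2 * inverse (real (Suc k)))"
    by (rule summable_comparison_test'[where N = 0])
       (use alpha \<epsilon> c(1) in \<open>auto simp: abs_mult\<close>)
  then have "summable (\<lambda>k. inverse (real (Suc k)))"
    using \<epsilon> c(1) by (subst (asm) summable_cmult_iff) auto
  then show False
    using not_summable_harmonic[where 'a = real] summable_Suc_iff[of "\<lambda>k. inverse (real k)"] by simp
qed

section \<open>Accumulation points of the iterates\<close>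

lemma accumulation_point_le:
  assumes "accumulation_point x p"
  shows "f i p \<le> f i (x k)"
proof -
  obtain r where r: "strict_mono r" "(x \<circ> r) \<longlonglongrightarrow> p"
    using assms unfolding accumulation_point_def by blast
  have "isCont (f i) p"
    using convex_continuous_on_UNIV[OF f_convex] by (simp add: continuous_on_eq_continuous_at)
  then have "(\<lambda>n. f i (x (r n))) \<longlonglongrightarrow> f i p"
    using isCont_tendsto_compose[OF _ r(2)] by (simp add: o_def)
  \<comment> \<open>A strictly increasing \<open>r\<close> satisfies \<open>n \<le> r n\<close>, so
    monotone descent along the whole run compares the subsequence with the iterate
    \<open>x k\<close>.\<close>
  moreover have "f i (x (r n)) \<le> f i (x k)" if "n \<ge> k" for n
    using decseqD[OF f_antimono, of k "r n" i] seq_suble[OF r(1), of n] that by linarith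
  ultimately show ?thesis by (intro LIMSEQ_le_const2) auto
qed

text \<open>A point that dominates an accumulation point \<open>p\<close> yields, by strong convexity, a midpoint
  that is better than \<open>p\<close>, and hence better than all iterates, by a fixed amount.\<close>

lemma accumulation_point_pareto_optimum:
  assumes bdd: "\<And>i. bdd_below (range (\<lambda>k. f i (x k)))" and acc: "accumulation_point x p"
  shows "pareto_optimum (\<lambda>z. \<chi> i. f i z) p"
  unfolding pareto_optimum_def
proof
  assume "\<exists>z. (\<chi> i. f i z) \<le> (\<chi> i. f i p) \<and> (\<chi> i. f i z) \<noteq> (\<chi> i. f i p)"
  then obtain z where z: "\<And>i. f i z \<le> f i p" "z \<noteq> p"
    by (auto simp: less_eq_vec_def)
  define w where "w = (1 / 2) *\<^sub>R z + (1 - 1 / 2) *\<^sub>R p"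
  have "\<exists>e>0. f i w + e \<le> f i p" for i
  proof -
    obtain \<eta> where \<eta>: "\<eta> > 0" and sc: "\<And>x y t. t \<in> {0..1} \<Longrightarrow> f i (t *\<^sub>R x + (1 - t) *\<^sub>R y)
        \<le> t * f i x + (1 - t) * f i y - 1 / 2 * t * (1 - t) * \<eta> * (norm (x - y))\<^sup>2"
      using f_strongly_convex[of i] unfolding strongly_convex_def by blast
    \<comment> \<open>At the midpoint the strong convexity term is
      \<open>1 / 2 * (1 / 2) * (1 / 2) * \<eta>\<close> times the squared distance.\<close>
    have "f i w + 1 / 8 * \<eta> * (norm (z - p))\<^sup>2 \<le> f i p"
      using sc[of "1 / 2" z p] z(1)[of i] unfolding w_def by (simp add: field_simps)
    moreover have "1 / 8 * \<eta> * (norm (z - p))\<^sup>2 > 0" using \<eta> z(2) by simp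
    ultimately show ?thesis by blast
  qed
  then obtain e where e: "\<And>i. e i > 0" "\<And>i. f i w + e i \<le> f i p" by metis
  \<comment> \<open>The least of the finitely many gains serves all objectives at once.\<close>
  have "f i w + Min (range e) \<le> f i (x k)" for i k
  proof -
    have "Min (range e) \<le> e i" by (intro Min_le) auto
    then show ?thesis using e(2)[of i] accumulation_point_le[OF acc, of i k] by linarith
  qed
  moreover have "Min (range e) > 0" using e(1) by auto
  ultimately show False using not_uniformly_improvable[OF bdd] by blast
qed

lemma accumulation_point_exists: "\<exists>p. accumulation_point x p"
proof -
  obtain R where "\<And>k. norm (x k) \<le> R" using iterates_bounded by blast
  then have "bounded (range x)" unfolding bounded_iff by blast
  then show ?thesis
    using bounded_imp_convergent_subsequence[of x] unfolding accumulation_point_def by blast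
qed

end

theorem theorem4p1:
  fixes F :: "real ^ 'n \<Rightarrow> real ^ 'm"
    and g h :: "'m::finite \<Rightarrow> real ^ 'n \<Rightarrow> real"
    and \<rho> \<zeta> \<sigma> :: real
    and x d :: "nat \<Rightarrow> real ^ 'n"
    and B :: "nat \<Rightarrow> 'm \<Rightarrow> real ^ 'n ^ 'n"
    and \<alpha> l :: "nat \<Rightarrow> real"
  assumes F: "F = (\<lambda>z. \<chi> i. g i z + h i z)"
    and g_C2: "\<And>i. twice_continuously_differentiable (g i)"
    and g_strongly_convex: "\<And>i. strongly_convex (g i)"
    and h_convex: "\<And>i. convex_on UNIV (h i)"
    and rho: "\<rho> \<in> {0<..<1}"
    and zeta: "\<zeta> \<in> {0<..<1}"
    and run: "infinite_bfgs_run g h \<rho> \<zeta> x B d \<alpha> l"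
    and sigma: "\<sigma> > 0"
    and B_bound: "\<And>z k i. z \<bullet> (B k i *v z) \<ge> \<sigma> * (norm z)\<^sup>2"
    and F_bounded_below: "\<And>i. bdd_below (range (\<lambda>k. F (x k) $ i))"
  shows "(\<forall>p. accumulation_point x p \<longrightarrow> pareto_stationary F p \<and> pareto_optimum F p) \<and>
         (bounded {z. F z \<le> F (x 0)} \<longrightarrow>
            (\<exists>p. accumulation_point x p) \<and>
            (\<forall>p. accumulation_point x p \<longrightarrow> pareto_stationary F p \<and> pareto_optimum F p))"
proof -
  interpret bfgs_run g h \<rho> \<zeta> \<sigma> x d B \<alpha> l
    using g_C2 g_strongly_convex h_convex rho zeta run sigma B_bound by unfold_locales auto
  have bdd: "bdd_below (range (\<lambda>k. g i (x k) + h i (x k)))" for i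
    using F_bounded_below[of i] unfolding F by simp
  have "pareto_stationary F p \<and> pareto_optimum F p" if "accumulation_point x p" for p
  proof
    show opt: "pareto_optimum F p"
      unfolding F by (rule accumulation_point_pareto_optimum[OF bdd that])
    show "pareto_stationary F p"
      by (rule pareto_optimum_imp_stationary[OF _ opt]) (simp add: F f_convex)
  qed
  then show ?thesis using accumulation_point_exists by blast
qed

end
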